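(* Let $\mathcal{T}$ be a metric equational theory over a metric signature $\Omega$, let $\Gamma$ be a context, and let $\phi$ be either a quantitative equality $s =_\varepsilon t$ or a formational atom $t\ ok$ (with $s,t$ preterms over $\Omega$). If every model of $\mathcal{T}$ satisfies the judgment $\Gamma \vdash \phi$, then $\Gamma \vdash_{\mathcal{T}} \phi$, i.e. $(\Gamma\vdash\phi)\in\mathcal{T}$.
   Context: $\mathbf{Met}$ is the category of extended metric spaces (sets with a metric $d: X\times X\to[0,\infty]$) and nonexpansive maps. For metric spaces $A,M$, $M^A$ denotes the set of nonexpansive maps $A\to M$ with the supremum metric. A metric signature $\Omega$ is a set of operation symbols, each $f$ equipped with a metric arity, i.e. a countable cardinal $N$ equipped with an extended metric $d$ (write $f:N\in\Omega$). Fix a countably infinite set $X$ of variables. Preterms are defined inductively: every variable is a preterm, and if $f:N\in\Omega$ and $t_i$ is a preterm for each $i\in N$, then $f((t_i)_{i\in N})$ is a preterm. A context $\Gamma$ is a list of quantitative equalities $x=_\varepsilon y$ with $x,y$ variables and $\varepsilon\ge 0$ real. A judgment is either formational, $\Gamma\vdash t\ ok$, or structural, $\Gamma\vdash s=_\varepsilon t$. A set of judgments is a deducibility relation if it is closed under the following rules (for all variables, symbols $f:(N,d)$, preterms, reals $\varepsilon,\varepsilon'\ge0$): (Var) $\Gamma\vdash x\ ok$; (Assum) if $x=_\varepsilon y\in\Gamma$ then $\Gamma\vdash x=_\varepsilon y$; (Refl) from $\Gamma\vdash t\ ok$ infer $\Gamma\vdash t=_0 t$; (Symm) from $\Gamma\vdash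 t'=_\varepsilon t$ infer $\Gamma\vdash t=_\varepsilon t'$; (Triang) from $\Gamma\vdash t=_\varepsilon t'$ and $\Gamma\vdash t'=_{\varepsilon'}t''$ infer $\Gamma\vdash t=_{\varepsilon+\varepsilon'}t''$; (Max) from $\varepsilon'<\varepsilon$ and $\Gamma\vdash t=_{\varepsilon'}t'$ infer $\Gamma\vdash t=_\varepsilon t'$; (Cont) from $\Gamma\vdash t=_{\varepsilon'}t'$ for all $\varepsilon'>\varepsilon$ infer $\Gamma\vdash t=_\varepsilon t'$; (Nexp) from $\Gamma\vdash s_i=_{d(i,j)}s_j$, $\Gamma\vdash t_i=_{d(i,j)}t_j$, $\Gamma\vdash s_i=_\varepsilon t_i$ for all $i,j\in N$ infer $\Gamma\vdash f((s_i))=_\varepsilon f((t_i))$; (Subst) from $\Gamma\vdash u_i=_{\delta_{ij}}u_j$ for all $i,j$ and $\{x_i=_{\delta_{ij}}x_j\}\vdash s=_\varepsilon t$ infer $\Gamma\vdash s[u_i/x_i]=_\varepsilon t[u_i/x_i]$; (App) from $\Gamma\vdash t_i\ ok$ for all $i$ and $\Gamma\vdash t_i=_{d(i,j)}t_j$ for all $i,j$ with $d(i,j)<\infty$ infer $\Gamma\vdash f((t_i))\ ok$. For a set $S$ of judgments, $\vdash_S$ is the least deducibility relation containing $S$. A set $S$ is well-formed if whenever $\Gamma\vdash t=_\varepsilon s\in S$, also $\Gamma\vdash t\ ok$ and $\Gamma\vdash s\ ok$ are in $S$. A metric equational theory $\mathcal T$ over $\Omega$ is a well-formed set of judgments with $\mathcal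 T=\vdash_{\mathcal T^=}$, where $\mathcal T^=$ is its subset of structural judgments; $\Gamma\vdash_{\mathcal T}\phi$ means $(\Gamma\vdash\phi)\in\mathcal T$. A model of $\Omega$ is a metric space $M$ with a map $M[f]:M^A\to M$ for each $f:A\in\Omega$. For a context $\Gamma$, let $M^\Gamma$ be the set of assignments $\alpha:X\to M$ satisfying $\Gamma$ (i.e. $d(\alpha(x),\alpha(y))\le\varepsilon$ for every $x=_\varepsilon y$ in $\Gamma$), with the supremum metric. Satisfaction and interpretations $M[t]:M^\Gamma\to M$ are defined recursively: (1) $M$ satisfies $\Gamma\vdash x\ ok$ for every variable $x$, and $M[x](\alpha)=\alpha(x)$; (2) $M$ satisfies $\Gamma\vdash f((t_i))\ ok$ iff it satisfies every $\Gamma\vdash t_i\ ok$ and $\sup_\alpha d(M[t_i](\alpha),M[t_j](\alpha))\le d_f(i,j)$ for all $i,j$, and then $M[f((t_i))](\alpha)=M[f]((M[t_i](\alpha))_i)$; (3) $M$ satisfies $\Gamma\vdash s=_\varepsilon t$ iff it satisfies $\Gamma\vdash s\ ok$ and $\Gamma\vdash t\ ok$ and $\sup_\alpha d(M[s](\alpha),M[t](\alpha))\le\varepsilon$. A model of $\mathcal T$ is a model of $\Omega$ satisfying every judgment in $\mathcal T$.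
   Formalization: The rule (Subst) is read liberally: all variables may be substituted at once, the premise context may be any context (pairs not listed are unconstrained), and each substituted term must be ok; (Nexp) skips pairs at infinite distance. With finitely many substituted variables the claim fails. *)

theory Defs
  imports Complex_Main
    "HOL-Library.Extended_Nonnegative_Real"
    "HOL-Library.FuncSet"
    "HOL-Library.Countable_Set"
begin

text \<open>The library's metric spaces are real-valued; here distances range over \<open>[0, \<infinity>]\<close>.\<close>

definition ext_metric_on :: "'a set \<Rightarrow> ('a \<Rightarrow> 'a \<Rightarrow> ennreal) \<Rightarrow> bool" where
  "ext_metric_on A d \<longleftrightarrow>
     (\<forall>x\<in>A. \<forall>y\<in>A. d x y = 0 \<longleftrightarrow> x = y) \<and>
     (\<forall>x\<in>A. \<forall>y\<in>A. d x y = d y x) \<and>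
     (\<forall>x\<in>A. \<forall>y\<in>A. \<forall>z\<in>A. d x z \<le> d x y + d y z)"

text \<open>The hom object \<open>M\<^sup>A\<close>: nonexpansive maps \<open>(A, dA) \<rightarrow> (M, dM)\<close>, made extensional so that
  they are determined by their values on \<open>A\<close>, and the supremum metric on it.\<close>

definition nonexp_maps ::
    "'a set \<Rightarrow> ('a \<Rightarrow> 'a \<Rightarrow> ennreal) \<Rightarrow> 'm set \<Rightarrow> ('m \<Rightarrow> 'm \<Rightarrow> ennreal) \<Rightarrow> ('a \<Rightarrow> 'm) set" where
  "nonexp_maps A dA M dM =
     {g \<in> A \<rightarrow>\<^sub>E M. \<forall>i\<in>A. \<forall>j\<in>A. dM (g i) (g j) \<le> dA i j}"

definition sup_dist ::
    "'a set \<Rightarrow> ('m \<Rightarrow> 'm \<Rightarrow> ennreal) \<Rightarrow> ('a \<Rightarrow> 'm) \<Rightarrow> ('a \<Rightarrow> 'm) \<Rightarrow> ennreal" where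
  "sup_dist A dM g h = (SUP i\<in>A. dM (g i) (h i))"


section \<open>Signatures and preterms\<close>

record 'f signature =
  ops :: "'f set"
  arity :: "'f \<Rightarrow> nat set"
  adist :: "'f \<Rightarrow> nat \<Rightarrow> nat \<Rightarrow> ennreal"

text \<open>A countable cardinal is a finite one, \<open>{..<n}\<close>, or \<open>\<omega>\<close>, the set of all naturals.\<close>

definition metric_signature :: "'f signature \<Rightarrow> bool" where
  "metric_signature \<Omega> \<longleftrightarrow>
     (\<forall>f\<in>ops \<Omega>. ((\<exists>n. arity \<Omega> f = {..<n}) \<or> arity \<Omega> f = UNIV) \<and>
                ext_metric_on (arity \<Omega> f) (adist \<Omega> f))"

text \<open>The variables are all elements of the type \<open>'x\<close>. The argument family of an operation is
  a total function on \<^typ>\<open>nat\<close>; the preterms over \<open>\<Omega>\<close> are the elements of the datatype that use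
  only symbols of \<open>\<Omega>\<close> and whose argument families are extensional on the arity, so that each
  such family corresponds to exactly one function on the arity.\<close>

datatype ('f, 'x) preterm = Var 'x | Op 'f "nat \<Rightarrow> ('f, 'x) preterm"

inductive_set preterms :: "'f signature \<Rightarrow> ('f, 'x) preterm set" for \<Omega> where
  Var: "Var x \<in> preterms \<Omega>"
| Op: "\<lbrakk>f \<in> ops \<Omega>; ts \<in> extensional (arity \<Omega> f); \<And>i. i \<in> arity \<Omega> f \<Longrightarrow> ts i \<in> preterms \<Omega>\<rbrakk>
       \<Longrightarrow> Op f ts \<in> preterms \<Omega>"

primrec psubst :: "'f signature \<Rightarrow> ('x \<Rightarrow> ('f, 'x) preterm) \<Rightarrow> ('f, 'x) preterm \<Rightarrow> ('f, 'x) preterm"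
where
  "psubst \<Omega> \<sigma> (Var x) = \<sigma> x"
| "psubst \<Omega> \<sigma> (Op f ts) = Op f (restrict (\<lambda>i. psubst \<Omega> \<sigma> (ts i)) (arity \<Omega> f))"


section \<open>Judgements and deducibility\<close>

text \<open>The triple \<open>(x, \<epsilon>, y)\<close> in a context stands for the quantitative equality
  \<open>x =\<^sub>\<epsilon> y\<close>.\<close>

type_synonym 'x ctxt = "('x \<times> real \<times> 'x) list"

datatype ('f, 'x) formula =
  Ok "('f, 'x) preterm"
| QEq "('f, 'x) preterm" real "('f, 'x) preterm"

type_synonym ('f, 'x) judgement = "'x ctxt \<times> ('f, 'x) formula"

definition contexts :: "'x ctxt set" where
  "contexts = {\<Gamma>. \<forall>(x, \<epsilon>, y) \<in> set \<Gamma>. 0 \<le> \<epsilon>}"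

definition formulas :: "'f signature \<Rightarrow> ('f, 'x) formula set" where
  "formulas \<Omega> = {Ok t |t. t \<in> preterms \<Omega>} \<union>
     {QEq s \<epsilon> t |s \<epsilon> t. s \<in> preterms \<Omega> \<and> t \<in> preterms \<Omega> \<and> 0 \<le> \<epsilon>}"

definition judgements :: "'f signature \<Rightarrow> ('f, 'x) judgement set" where
  "judgements \<Omega> = contexts \<times> formulas \<Omega>"

definition structural :: "('f, 'x) judgement set \<Rightarrow> ('f, 'x) judgement set" where
  "structural S = {J \<in> S. \<exists>\<Gamma> s \<epsilon> t. J = (\<Gamma>, QEq s \<epsilon> t)}"

text \<open>The least deducibility relation containing \<open>S\<close>. An equality \<open>s =\<^sub>\<infinity> t\<close> is no judgement,
  so the premises indexed by an infinite distance are absent, in \<open>Nexp\<close> as in \<open>App\<close>.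

  \<open>Subst\<close> replaces a family of variables \<open>x\<^sub>i\<close> by preterms \<open>u\<^sub>i = \<sigma> x\<^sub>i\<close>, where \<open>\<Delta>\<close> lists
  the equalities between the \<open>x\<^sub>i\<close> at finite distance. The substitution acts on all variables
  simultaneously, since a preterm may contain infinitely many of them, including ones not
  occurring in \<open>\<Delta>\<close>; a variable that is to be kept has \<open>\<sigma> x = Var x\<close>. That each \<open>\<sigma> x\<close> is
  ok is what the diagonal premises, equating \<open>u\<^sub>i\<close> with itself, amount to in a well-formed
  set; without it every preterm would be forced to be ok.\<close>

inductive_set deducible :: "'f signature \<Rightarrow> ('f, 'x) judgement set \<Rightarrow> ('f, 'x) judgement set"
  for \<Omega> :: "'f signature" and S :: "('f, 'x) judgement set" where
  Axiom: "J \<in> S \<Longrightarrow> J \<in> deducible \<Omega> S"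
| Var: "\<Gamma> \<in> contexts \<Longrightarrow> (\<Gamma>, Ok (Var x)) \<in> deducible \<Omega> S"
| Assum: "\<lbrakk>\<Gamma> \<in> contexts; (x, \<epsilon>, y) \<in> set \<Gamma>\<rbrakk> \<Longrightarrow> (\<Gamma>, QEq (Var x) \<epsilon> (Var y)) \<in> deducible \<Omega> S"
| Refl: "(\<Gamma>, Ok t) \<in> deducible \<Omega> S \<Longrightarrow> (\<Gamma>, QEq t 0 t) \<in> deducible \<Omega> S"
| Symm: "(\<Gamma>, QEq t' \<epsilon> t) \<in> deducible \<Omega> S \<Longrightarrow> (\<Gamma>, QEq t \<epsilon> t') \<in> deducible \<Omega> S"
| Triang: "\<lbrakk>(\<Gamma>, QEq t \<epsilon> t') \<in> deducible \<Omega> S; (\<Gamma>, QEq t' \<epsilon>' t'') \<in> deducible \<Omega> S\<rbrakk>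
     \<Longrightarrow> (\<Gamma>, QEq t (\<epsilon> + \<epsilon>') t'') \<in> deducible \<Omega> S"
| Max: "\<lbrakk>\<epsilon>' < \<epsilon>; (\<Gamma>, QEq t \<epsilon>' t') \<in> deducible \<Omega> S\<rbrakk> \<Longrightarrow> (\<Gamma>, QEq t \<epsilon> t') \<in> deducible \<Omega> S"
| Cont: "\<lbrakk>0 \<le> \<epsilon>; \<And>\<epsilon>'. \<epsilon> < \<epsilon>' \<Longrightarrow> (\<Gamma>, QEq t \<epsilon>' t') \<in> deducible \<Omega> S\<rbrakk>
     \<Longrightarrow> (\<Gamma>, QEq t \<epsilon> t') \<in> deducible \<Omega> S"
| Nexp: "\<lbrakk>\<Gamma> \<in> contexts; 0 \<le> \<epsilon>; Op f s \<in> preterms \<Omega>; Op f t \<in> preterms \<Omega>;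
      \<And>i j. \<lbrakk>i \<in> arity \<Omega> f; j \<in> arity \<Omega> f; adist \<Omega> f i j < \<infinity>\<rbrakk>
        \<Longrightarrow> (\<Gamma>, QEq (s i) (enn2real (adist \<Omega> f i j)) (s j)) \<in> deducible \<Omega> S;
      \<And>i j. \<lbrakk>i \<in> arity \<Omega> f; j \<in> arity \<Omega> f; adist \<Omega> f i j < \<infinity>\<rbrakk>
        \<Longrightarrow> (\<Gamma>, QEq (t i) (enn2real (adist \<Omega> f i j)) (t j)) \<in> deducible \<Omega> S;
      \<And>i. i \<in> arity \<Omega> f \<Longrightarrow> (\<Gamma>, QEq (s i) \<epsilon> (t i)) \<in> deducible \<Omega> S\<rbrakk>
     \<Longrightarrow> (\<Gamma>, QEq (Op f s) \<epsilon> (Op f t)) \<in> deducible \<Omega> S"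
| Subst: "\<lbrakk>\<And>x. (\<Gamma>, Ok (\<sigma> x)) \<in> deducible \<Omega> S;
      \<And>x \<delta> y. (x, \<delta>, y) \<in> set \<Delta> \<Longrightarrow> (\<Gamma>, QEq (\<sigma> x) \<delta> (\<sigma> y)) \<in> deducible \<Omega> S;
      (\<Delta>, QEq s \<epsilon> t) \<in> deducible \<Omega> S\<rbrakk>
     \<Longrightarrow> (\<Gamma>, QEq (psubst \<Omega> \<sigma> s) \<epsilon> (psubst \<Omega> \<sigma> t)) \<in> deducible \<Omega> S"
| App: "\<lbrakk>\<Gamma> \<in> contexts; Op f t \<in> preterms \<Omega>;
      \<And>i. i \<in> arity \<Omega> f \<Longrightarrow> (\<Gamma>, Ok (t i)) \<in> deducible \<Omega> S;
      \<And>i j. \<lbrakk>i \<in> arity \<Omega> f; j \<in> arity \<Omega> f; adist \<Omega> f i j < \<infinity>\<rbrakk>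
        \<Longrightarrow> (\<Gamma>, QEq (t i) (enn2real (adist \<Omega> f i j)) (t j)) \<in> deducible \<Omega> S\<rbrakk>
     \<Longrightarrow> (\<Gamma>, Ok (Op f t)) \<in> deducible \<Omega> S"

definition well_formed :: "('f, 'x) judgement set \<Rightarrow> bool" where
  "well_formed S \<longleftrightarrow>
     (\<forall>\<Gamma> t \<epsilon> s. (\<Gamma>, QEq t \<epsilon> s) \<in> S \<longrightarrow> (\<Gamma>, Ok t) \<in> S \<and> (\<Gamma>, Ok s) \<in> S)"

definition metric_equational_theory :: "'f signature \<Rightarrow> ('f, 'x) judgement set \<Rightarrow> bool" where
  "metric_equational_theory \<Omega> T \<longleftrightarrow>
     T \<subseteq> judgements \<Omega> \<and> well_formed T \<and> T = deducible \<Omega> (structural T)"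


section \<open>Models\<close>

record ('f, 'm) model =
  carrier :: "'m set"
  mdist :: "'m \<Rightarrow> 'm \<Rightarrow> ennreal"
  opn :: "'f \<Rightarrow> (nat \<Rightarrow> 'm) \<Rightarrow> 'm"

abbreviation hom_power ::
    "'f signature \<Rightarrow> ('f, 'm) model \<Rightarrow> 'f \<Rightarrow> (nat \<Rightarrow> 'm) set" where
  "hom_power \<Omega> M f \<equiv> nonexp_maps (arity \<Omega> f) (adist \<Omega> f) (carrier M) (mdist M)"

text \<open>The interpretation of \<open>f\<close> is a morphism \<open>M\<^sup>A \<rightarrow> M\<close> of extended metric spaces, that is, a
  nonexpansive map.\<close>

definition signature_model :: "'f signature \<Rightarrow> ('f, 'm) model \<Rightarrow> bool" where
  "signature_model \<Omega> M \<longleftrightarrow>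
     ext_metric_on (carrier M) (mdist M) \<and>
     (\<forall>f\<in>ops \<Omega>.
        opn M f \<in> hom_power \<Omega> M f \<rightarrow> carrier M \<and>
        (\<forall>g\<in>hom_power \<Omega> M f. \<forall>h\<in>hom_power \<Omega> M f.
           mdist M (opn M f g) (opn M f h) \<le> sup_dist (arity \<Omega> f) (mdist M) g h))"

definition assignments :: "('f, 'm) model \<Rightarrow> 'x ctxt \<Rightarrow> ('x \<Rightarrow> 'm) set" where
  "assignments M \<Gamma> = {\<alpha>. range \<alpha> \<subseteq> carrier M \<and>
     (\<forall>(x, \<epsilon>, y) \<in> set \<Gamma>. mdist M (\<alpha> x) (\<alpha> y) \<le> ennreal \<epsilon>)}"

text \<open>The interpretation is a total function, but it is meaningful only at preterms \<open>t\<close> with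
  \<open>sat_ok \<Omega> M \<Gamma> t\<close> and assignments in \<open>M\<^sup>\<Gamma>\<close>; only there do the argument tuples
  lie in the domain of the operations.\<close>

primrec interp :: "'f signature \<Rightarrow> ('f, 'm) model \<Rightarrow> ('f, 'x) preterm \<Rightarrow> ('x \<Rightarrow> 'm) \<Rightarrow> 'm" where
  "interp \<Omega> M (Var x) = (\<lambda>\<alpha>. \<alpha> x)"
| "interp \<Omega> M (Op f ts) = (\<lambda>\<alpha>. opn M f (restrict (\<lambda>i. interp \<Omega> M (ts i) \<alpha>) (arity \<Omega> f)))"

primrec sat_ok :: "'f signature \<Rightarrow> ('f, 'm) model \<Rightarrow> 'x ctxt \<Rightarrow> ('f, 'x) preterm \<Rightarrow> bool" where
  "sat_ok \<Omega> M \<Gamma> (Var x) \<longleftrightarrow> True"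
| "sat_ok \<Omega> M \<Gamma> (Op f ts) \<longleftrightarrow>
     (\<forall>i\<in>arity \<Omega> f. sat_ok \<Omega> M \<Gamma> (ts i)) \<and>
     (\<forall>i\<in>arity \<Omega> f. \<forall>j\<in>arity \<Omega> f.
        sup_dist (assignments M \<Gamma>) (mdist M) (interp \<Omega> M (ts i)) (interp \<Omega> M (ts j)) \<le> adist \<Omega> f i j)"

fun satisfies :: "'f signature \<Rightarrow> ('f, 'm) model \<Rightarrow> ('f, 'x) judgement \<Rightarrow> bool" where
  "satisfies \<Omega> M (\<Gamma>, Ok t) \<longleftrightarrow> sat_ok \<Omega> M \<Gamma> t"
| "satisfies \<Omega> M (\<Gamma>, QEq s \<epsilon> t) \<longleftrightarrow> sat_ok \<Omega> M \<Gamma> s \<and> sat_ok \<Omega> M \<Gamma> t \<and>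
     sup_dist (assignments M \<Gamma>) (mdist M) (interp \<Omega> M s) (interp \<Omega> M t) \<le> ennreal \<epsilon>"

definition theory_model ::
    "'f signature \<Rightarrow> ('f, 'x) judgement set \<Rightarrow> ('f, 'm) model \<Rightarrow> bool" where
  "theory_model \<Omega> T M \<longleftrightarrow> signature_model \<Omega> M \<and> (\<forall>J\<in>T. satisfies \<Omega> M J)"

end

theory Submission
  imports Defs
begin

text \<open>
  The terms that \<open>T\<close> proves ok in context \<open>\<Gamma>\<close>, modulo provable equality \<open>s =\<^sub>0 t\<close> and at
  distance the infimum of all \<open>\<epsilon>\<close> with \<open>\<Gamma> \<turnstile> s =\<^sub>\<epsilon> t\<close> in \<open>T\<close>, form a model of \<open>T\<close>: by \<open>Cont\<close>
  the infimum is attained, an assignment satisfying a context \<open>\<Delta>\<close> is the same as a substitution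
  to which \<open>Subst\<close> applies, and the interpretation of a term under it is the class of the
  substituted term. Since \<open>T\<close> is generated by its structural judgements, \<open>\<Delta> \<turnstile> f(t\<^sub>i) ok\<close> can
  only come from \<open>App\<close>, which makes this provable by induction on the term. At the assignment
  sending every variable to its own class, satisfaction of a judgement in context \<open>\<Gamma>\<close> is
  membership in \<open>T\<close>.
\<close>

text \<open>Only real distances occur in judgements, so inequalities between extended distances are
  tested against real upper bounds; for y infinite nothing is to be shown.\<close>

lemma ennreal_le_by_real_bounds:
  fixes x y :: ennreal
  assumes "\<And>\<epsilon>. 0 \<le> \<epsilon> \<Longrightarrow> y \<le> ennreal \<epsilon> \<Longrightarrow> x \<le> ennreal \<epsilon>"
  shows "x \<le> y"
  using assms by (cases y) auto

lemma sup_dist_leD: "\<lbrakk>sup_dist A d g h \<le> e; i \<in> A\<rbrakk> \<Longrightarrow> d (g i) (h i) \<le> e"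
  by (simp add: sup_dist_def SUP_le_iff)

text \<open>\<Gamma> is the fixed context whose terms make up the model; the judgements of
  \<open>T\<close> to be checked in it live in arbitrary contexts, written \<Delta> below.\<close>

locale theory_in_context =
  fixes \<Omega> :: "'f signature"
    and T :: "('f, 'x) judgement set"
    and \<Gamma> :: "'x ctxt"
  assumes metric_theory: "metric_equational_theory \<Omega> T"
    and ctxt: "\<Gamma> \<in> contexts"
begin

section \<open>Closure and inversion properties of a theory\<close>

lemma T_eq: "T = deducible \<Omega> (structural T)"
  using metric_theory unfolding metric_equational_theory_def by blast

lemmas refl = deducible.Refl[where \<Omega> = \<Omega> and S = "structural T", folded T_eq]
lemmas symm = deducible.Symm[where \<Omega> = \<Omega> and S = "structural T", folded T_eq]
lemmas triang = deducible.Triang[where \<Omega> = \<Omega> and S = "structural T", folded T_eq]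
lemmas max = deducible.Max[where \<Omega> = \<Omega> and S = "structural T", folded T_eq]
lemmas cont = deducible.Cont[where \<Omega> = \<Omega> and S = "structural T", folded T_eq]
lemmas nexp = deducible.Nexp[where \<Omega> = \<Omega> and S = "structural T", folded T_eq]
lemmas subst_rule = deducible.Subst[where \<Omega> = \<Omega> and S = "structural T", folded T_eq]
lemmas app = deducible.App[where \<Omega> = \<Omega> and S = "structural T", folded T_eq]
lemmas var = deducible.Var[where \<Omega> = \<Omega> and S = "structural T", folded T_eq]
lemmas assum = deducible.Assum[where \<Omega> = \<Omega> and S = "structural T", folded T_eq]

lemma QEq_imp_ok:
  assumes "(\<Delta>, QEq s \<epsilon> t) \<in> T"
  shows "(\<Delta>, Ok s) \<in> T" and "(\<Delta>, Ok t) \<in> T"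
  using assms metric_theory unfolding metric_equational_theory_def well_formed_def by blast+

lemma QEq_nonneg: "(\<Delta>, QEq s \<epsilon> t) \<in> T \<Longrightarrow> 0 \<le> \<epsilon>"
  using metric_theory
  unfolding metric_equational_theory_def judgements_def formulas_def by blast

lemma ok_imp_preterm: "(\<Delta>, Ok t) \<in> T \<Longrightarrow> t \<in> preterms \<Omega>"
  using metric_theory
  unfolding metric_equational_theory_def judgements_def formulas_def by blast

lemma ok_OpD:
  assumes "(\<Delta>, Ok (Op f ts)) \<in> T"
  shows "i \<in> arity \<Omega> f \<Longrightarrow> (\<Delta>, Ok (ts i)) \<in> T"
    and "\<lbrakk>i \<in> arity \<Omega> f; j \<in> arity \<Omega> f; adist \<Omega> f i j < \<infinity>\<rbrakk>
      \<Longrightarrow> (\<Delta>, QEq (ts i) (enn2real (adist \<Omega> f i j)) (ts j)) \<in> T"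
proof -
  have "(\<Delta>, Ok (Op f ts)) \<in> deducible \<Omega> (structural T)"
    using assms by (simp only: T_eq[symmetric])
  then have "(\<forall>i\<in>arity \<Omega> f. (\<Delta>, Ok (ts i)) \<in> deducible \<Omega> (structural T)) \<and>
    (\<forall>i\<in>arity \<Omega> f. \<forall>j\<in>arity \<Omega> f. adist \<Omega> f i j < \<infinity> \<longrightarrow>
      (\<Delta>, QEq (ts i) (enn2real (adist \<Omega> f i j)) (ts j)) \<in> deducible \<Omega> (structural T))"
    \<comment> \<open>\<open>Axiom\<close> yields only equalities here and \<open>Subst\<close>
      concludes only equalities, so \<open>App\<close> is the one rule left.\<close>
    by cases (auto simp: structural_def)
  then show "i \<in> arity \<Omega> f \<Longrightarrow> (\<Delta>, Ok (ts i)) \<in> T"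
    and "\<lbrakk>i \<in> arity \<Omega> f; j \<in> arity \<Omega> f; adist \<Omega> f i j < \<infinity>\<rbrakk>
      \<Longrightarrow> (\<Delta>, QEq (ts i) (enn2real (adist \<Omega> f i j)) (ts j)) \<in> T"
    unfolding T_eq[symmetric] by blast+
qed

lemma ok_Op_preterm:
  assumes "(\<Delta>, Ok (Op f ts)) \<in> T"
  shows "f \<in> ops \<Omega>" and "ts \<in> extensional (arity \<Omega> f)"
  using ok_imp_preterm[OF assms] by (auto elim: preterms.cases)

section \<open>The term model as an extended metric space\<close>

definition cls :: "('f, 'x) preterm \<Rightarrow> ('f, 'x) preterm set" where
  "cls s = {t. (\<Gamma>, QEq s 0 t) \<in> T}"

definition rep :: "('f, 'x) preterm set \<Rightarrow> ('f, 'x) preterm" where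
  "rep C = (SOME t. t \<in> C)"

text \<open>Distances and operations are computed on chosen representatives;
  \<open>dst_le_iff\<close> and \<open>opn_cls\<close> show that the choice is immaterial. The
  infimum over an empty set is infinite, so terms with no provable equality between them lie
  infinitely far apart.\<close>

definition term_model :: "('f, ('f, 'x) preterm set) model" where
  "term_model = \<lparr>
     carrier = {cls t |t. (\<Gamma>, Ok t) \<in> T},
     mdist = (\<lambda>C D. INF \<epsilon>\<in>{\<epsilon>. (\<Gamma>, QEq (rep C) \<epsilon> (rep D)) \<in> T}. ennreal \<epsilon>),
     opn = (\<lambda>f g. cls (Op f (restrict (\<lambda>i. rep (g i)) (arity \<Omega> f))))\<rparr>"

abbreviation dst where "dst \<equiv> mdist term_model"

lemma cls_eq_iff:
  assumes "(\<Gamma>, Ok t) \<in> T"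
  shows "cls s = cls t \<longleftrightarrow> (\<Gamma>, QEq s 0 t) \<in> T"
proof
  assume "cls s = cls t"
  then show "(\<Gamma>, QEq s 0 t) \<in> T"
    using refl[OF assms] unfolding cls_def by blast
next
  assume eq: "(\<Gamma>, QEq s 0 t) \<in> T"
  show "cls s = cls t"
    using triang[OF eq] triang[OF symm[OF eq]] unfolding cls_def by fastforce
qed

lemma rep_cls:
  assumes "(\<Gamma>, Ok t) \<in> T"
  shows "(\<Gamma>, QEq t 0 (rep (cls t))) \<in> T"
proof -
  have "t \<in> cls t"
    using refl[OF assms] by (simp add: cls_def)
  then have "rep (cls t) \<in> cls t"
    unfolding rep_def by (rule someI)
  then show ?thesis by (simp add: cls_def)
qed

lemma carrier_rep:
  assumes "C \<in> carrier term_model"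
  shows "(\<Gamma>, Ok (rep C)) \<in> T" and "cls (rep C) = C"
proof -
  obtain t where t: "(\<Gamma>, Ok t) \<in> T" "C = cls t"
    using assms by (auto simp: term_model_def)
  show *: "(\<Gamma>, Ok (rep C)) \<in> T"
    using QEq_imp_ok(2)[OF rep_cls[OF t(1)]] t(2) by simp
  show "cls (rep C) = C"
    using cls_eq_iff[OF *, of t] rep_cls[OF t(1)] t(2) by metis
qed

lemma cls_in_carrier: "(\<Gamma>, Ok t) \<in> T \<Longrightarrow> cls t \<in> carrier term_model"
  by (auto simp: term_model_def)

text \<open>\<open>Max\<close> and \<open>Cont\<close> make the provable bounds a closed up-set, so
  the infimum is itself provable when finite. This translates between metric and deduction.\<close>

lemma dst_le_iff:
  assumes s: "(\<Gamma>, Ok s) \<in> T" and t: "(\<Gamma>, Ok t) \<in> T" and "0 \<le> \<epsilon>"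
  shows "dst (cls s) (cls t) \<le> ennreal \<epsilon> \<longleftrightarrow> (\<Gamma>, QEq s \<epsilon> t) \<in> T"
proof
  assume le: "dst (cls s) (cls t) \<le> ennreal \<epsilon>"
  show "(\<Gamma>, QEq s \<epsilon> t) \<in> T"
  proof (rule cont[OF \<open>0 \<le> \<epsilon>\<close>])
    fix \<epsilon>' assume "\<epsilon> < \<epsilon>'"
    then have "dst (cls s) (cls t) < ennreal \<epsilon>'"
      using le \<open>0 \<le> \<epsilon>\<close> by (meson ennreal_lessI le_less_trans)
    then obtain \<delta> where \<delta>: "(\<Gamma>, QEq (rep (cls s)) \<delta> (rep (cls t))) \<in> T" "ennreal \<delta> < ennreal \<epsilon>'"
      by (auto simp: term_model_def INF_less_iff)
    have "\<delta> < \<epsilon>'"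
      using \<delta>(2) QEq_nonneg[OF \<delta>(1)] by (simp add: ennreal_less_iff)
    \<comment> \<open>Passing between a term and its representative costs distance 0 at either
      end.\<close>
    moreover have "(\<Gamma>, QEq s \<delta> t) \<in> T"
      using triang[OF triang[OF rep_cls[OF s] \<delta>(1)] symm[OF rep_cls[OF t]]] by simp
    ultimately show "(\<Gamma>, QEq s \<epsilon>' t) \<in> T"
      by (rule max)
  qed
next
  assume "(\<Gamma>, QEq s \<epsilon> t) \<in> T"
  then have "(\<Gamma>, QEq (rep (cls s)) \<epsilon> (rep (cls t))) \<in> T"
    using triang[OF triang[OF symm[OF rep_cls[OF s]]] rep_cls[OF t]] by fastforce
  then show "dst (cls s) (cls t) \<le> ennreal \<epsilon>"
    by (auto simp: term_model_def intro: INF_lower)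
qed

lemma dst_le_iff_finite:
  assumes s: "(\<Gamma>, Ok s) \<in> T" and t: "(\<Gamma>, Ok t) \<in> T"
  shows "dst (cls s) (cls t) \<le> e \<longleftrightarrow> (e < \<infinity> \<longrightarrow> (\<Gamma>, QEq s (enn2real e) t) \<in> T)"
  using dst_le_iff[OF assms] by (cases e) auto

lemma dst_le_iff_rep:
  assumes "C \<in> carrier term_model" and "D \<in> carrier term_model" and "0 \<le> \<epsilon>"
  shows "dst C D \<le> ennreal \<epsilon> \<longleftrightarrow> (\<Gamma>, QEq (rep C) \<epsilon> (rep D)) \<in> T"
  using dst_le_iff[OF carrier_rep(1)[OF assms(1)] carrier_rep(1)[OF assms(2)] assms(3)]
  by (simp add: carrier_rep(2)[OF assms(1)] carrier_rep(2)[OF assms(2)])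

lemma ext_metric_term_model: "ext_metric_on (carrier term_model) dst"
proof -
  let ?c = "carrier term_model"
  have zero: "dst C D = 0 \<longleftrightarrow> C = D" if "C \<in> ?c" "D \<in> ?c" for C D
  proof -
    have "dst C D = 0 \<longleftrightarrow> (\<Gamma>, QEq (rep C) 0 (rep D)) \<in> T"
      using dst_le_iff_rep[OF that, of 0] by simp
    also have "\<dots> \<longleftrightarrow> C = D"
      using cls_eq_iff[OF carrier_rep(1)[OF that(2)], of "rep C"] that
      by (simp add: carrier_rep(2))
    finally show ?thesis .
  qed
  have sym_le: "dst C D \<le> dst D C" if "C \<in> ?c" "D \<in> ?c" for C D
  proof (rule ennreal_le_by_real_bounds)
    fix \<epsilon> :: real assume "0 \<le> \<epsilon>" "dst D C \<le> ennreal \<epsilon>"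
    then show "dst C D \<le> ennreal \<epsilon>"
      using dst_le_iff_rep[OF that] dst_le_iff_rep[OF that(2,1)] symm by blast
  qed
  have tri: "dst C E \<le> dst C D + dst D E" if "C \<in> ?c" "D \<in> ?c" "E \<in> ?c" for C D E
  \<comment> \<open>An infinite summand makes the bound trivial; otherwise both distances are
    attained and \<open>Triang\<close> applies.\<close>
  proof (cases rule: ennreal2_cases[of "dst C D" "dst D E", case_names finite])
    case (finite r q)
    then have "(\<Gamma>, QEq (rep C) r (rep D)) \<in> T" "(\<Gamma>, QEq (rep D) q (rep E)) \<in> T"
      using dst_le_iff_rep[OF that(1,2), of r] dst_le_iff_rep[OF that(2,3), of q] by simp_all
    then have "(\<Gamma>, QEq (rep C) (r + q) (rep E)) \<in> T"
      by (rule triang)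
    then have "dst C E \<le> ennreal (r + q)"
      using dst_le_iff_rep[OF that(1,3), of "r + q"] finite by simp
    then show ?thesis
      using finite by simp
  qed simp_all
  show ?thesis
    unfolding ext_metric_on_def
  proof (intro conjI ballI)
    fix C D assume "C \<in> ?c" "D \<in> ?c"
    then show "dst C D = dst D C"
      by (intro antisym sym_le)
  qed (fact zero tri)+
qed

section \<open>Operations on the term model\<close>

text \<open>Nonexpansiveness of g supplies exactly the distance premises of
  \<open>App\<close>.\<close>

lemma ok_Op_reps:
  assumes "f \<in> ops \<Omega>" and g: "g \<in> hom_power \<Omega> term_model f"
  shows "(\<Gamma>, Ok (Op f (restrict (\<lambda>i. rep (g i)) (arity \<Omega> f)))) \<in> T"
proof -
  have car: "g i \<in> carrier term_model" if "i \<in> arity \<Omega> f" for i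
    using g that by (auto simp: nonexp_maps_def)
  have ok: "(\<Gamma>, Ok (rep (g i))) \<in> T" "cls (rep (g i)) = g i" if "i \<in> arity \<Omega> f" for i
    using carrier_rep[OF car[OF that]] by simp_all
  have le: "dst (g i) (g j) \<le> adist \<Omega> f i j" if "i \<in> arity \<Omega> f" "j \<in> arity \<Omega> f" for i j
    using g that by (auto simp: nonexp_maps_def)
  show ?thesis
  proof (rule app[OF ctxt])
    show "Op f (restrict (\<lambda>i. rep (g i)) (arity \<Omega> f)) \<in> preterms \<Omega>"
      using assms(1) ok_imp_preterm[OF ok(1)] by (auto intro: preterms.Op)
  next
    fix i j assume ij: "i \<in> arity \<Omega> f" "j \<in> arity \<Omega> f" "adist \<Omega> f i j < \<infinity>"
    then show "(\<Gamma>, QEq (restrict (\<lambda>i. rep (g i)) (arity \<Omega> f) i) (enn2real (adist \<Omega> f i j))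
        (restrict (\<lambda>i. rep (g i)) (arity \<Omega> f) j)) \<in> T"
      using dst_le_iff_finite[OF ok(1)[OF ij(1)] ok(1)[OF ij(2)]] le[OF ij(1,2)] ok(2) by simp
  qed (simp add: ok)
qed

text \<open>Inverting the two ok judgements recovers the premises of \<open>Nexp\<close> within each
  argument family.\<close>

lemma nexp_ok:
  assumes s: "(\<Gamma>, Ok (Op f s)) \<in> T" and t: "(\<Gamma>, Ok (Op f t)) \<in> T" and "0 \<le> \<epsilon>"
    and "\<And>i. i \<in> arity \<Omega> f \<Longrightarrow> (\<Gamma>, QEq (s i) \<epsilon> (t i)) \<in> T"
  shows "(\<Gamma>, QEq (Op f s) \<epsilon> (Op f t)) \<in> T"
  using assms by (intro nexp ctxt ok_imp_preterm[OF s] ok_imp_preterm[OF t] ok_OpD(2)) auto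

lemma signature_model_term_model: "signature_model \<Omega> term_model"
proof -
  have "dst (opn term_model f g) (opn term_model f h) \<le> sup_dist (arity \<Omega> f) dst g h"
    if f: "f \<in> ops \<Omega>" and g: "g \<in> hom_power \<Omega> term_model f" and h: "h \<in> hom_power \<Omega> term_model f"
    for f g h
  proof (rule ennreal_le_by_real_bounds)
    fix \<epsilon> :: real assume \<epsilon>: "0 \<le> \<epsilon>" "sup_dist (arity \<Omega> f) dst g h \<le> ennreal \<epsilon>"
    have "(\<Gamma>, QEq (rep (g i)) \<epsilon> (rep (h i))) \<in> T" if i: "i \<in> arity \<Omega> f" for i
    proof -
      have "g i \<in> carrier term_model" "h i \<in> carrier term_model"
        using g h i by (auto simp: nonexp_maps_def)
      moreover have "dst (g i) (h i) \<le> ennreal \<epsilon>"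
        using \<epsilon>(2) i by (rule sup_dist_leD)
      ultimately show ?thesis
        using dst_le_iff_rep \<epsilon>(1) by blast
    qed
    then have "(\<Gamma>, QEq (Op f (restrict (\<lambda>i. rep (g i)) (arity \<Omega> f))) \<epsilon>
        (Op f (restrict (\<lambda>i. rep (h i)) (arity \<Omega> f)))) \<in> T"
      using \<epsilon>(1) by (intro nexp_ok ok_Op_reps f g h) auto
    then show "dst (opn term_model f g) (opn term_model f h) \<le> ennreal \<epsilon>"
      using dst_le_iff[OF ok_Op_reps[OF f g] ok_Op_reps[OF f h] \<epsilon>(1)]
      by (simp add: term_model_def)
  qed
  moreover have "opn term_model f g \<in> carrier term_model"
    if "f \<in> ops \<Omega>" "g \<in> hom_power \<Omega> term_model f" for f g
    using cls_in_carrier[OF ok_Op_reps[OF that]] by (simp add: term_model_def)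
  ultimately show ?thesis
    unfolding signature_model_def using ext_metric_term_model by blast
qed

text \<open>Replacing each argument by its representative changes it by distance 0, which
  \<open>Nexp\<close> carries over to the whole term.\<close>

lemma opn_cls:
  assumes ok: "(\<Gamma>, Ok (Op f ts)) \<in> T"
  shows "opn term_model f (restrict (\<lambda>i. cls (ts i)) (arity \<Omega> f)) = cls (Op f ts)"
proof -
  let ?g = "restrict (\<lambda>i. cls (ts i)) (arity \<Omega> f)"
  have "?g \<in> hom_power \<Omega> term_model f"
    using ok_OpD[OF ok] cls_in_carrier dst_le_iff_finite by (auto simp: nonexp_maps_def)
  then have reps: "(\<Gamma>, Ok (Op f (restrict (\<lambda>i. rep (?g i)) (arity \<Omega> f)))) \<in> T"
    by (intro ok_Op_reps ok_Op_preterm(1)[OF ok])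
  have "(\<Gamma>, QEq (Op f (restrict (\<lambda>i. rep (?g i)) (arity \<Omega> f))) 0 (Op f ts)) \<in> T"
    using symm[OF rep_cls[OF ok_OpD(1)[OF ok]]] by (intro nexp_ok reps ok) auto
  then show ?thesis
    using cls_eq_iff[OF ok] by (simp add: term_model_def)
qed

section \<open>Assignments as substitutions, and soundness\<close>

lemma assignment_reps:
  assumes "\<alpha> \<in> assignments term_model \<Delta>" and \<Delta>: "\<Delta> \<in> contexts"
  shows "(\<Gamma>, Ok (rep (\<alpha> x))) \<in> T" and "cls (rep (\<alpha> x)) = \<alpha> x"
    and "(\<Delta>, QEq s \<epsilon> t) \<in> T \<Longrightarrow>
      (\<Gamma>, QEq (psubst \<Omega> (\<lambda>x. rep (\<alpha> x)) s) \<epsilon> (psubst \<Omega> (\<lambda>x. rep (\<alpha> x)) t)) \<in> T"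
proof -
  have car: "\<alpha> x \<in> carrier term_model" for x
    using assms by (auto simp: assignments_def)
  show ok: "(\<Gamma>, Ok (rep (\<alpha> x))) \<in> T" "cls (rep (\<alpha> x)) = \<alpha> x" for x
    using carrier_rep[OF car] by simp_all
  have "(\<Gamma>, QEq (rep (\<alpha> x)) \<delta> (rep (\<alpha> y))) \<in> T" if "(x, \<delta>, y) \<in> set \<Delta>" for x \<delta> y
  proof -
    have "0 \<le> \<delta>" "dst (\<alpha> x) (\<alpha> y) \<le> ennreal \<delta>"
      using assms that by (auto simp: assignments_def contexts_def)
    then show ?thesis
      using dst_le_iff_rep[OF car car] by blast
  qed
  then show "(\<Gamma>, QEq (psubst \<Omega> (\<lambda>x. rep (\<alpha> x)) s) \<epsilon> (psubst \<Omega> (\<lambda>x. rep (\<alpha> x)) t)) \<in> T"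
    if "(\<Delta>, QEq s \<epsilon> t) \<in> T"
    using subst_rule[of \<Gamma> "\<lambda>x. rep (\<alpha> x)"] ok(1) that by blast
qed

lemma interp_term_model:
  assumes \<alpha>: "\<alpha> \<in> assignments term_model \<Delta>" and \<Delta>: "\<Delta> \<in> contexts"
  shows "(\<Delta>, Ok t) \<in> T \<Longrightarrow> interp \<Omega> term_model t \<alpha> = cls (psubst \<Omega> (\<lambda>x. rep (\<alpha> x)) t)"
proof (induction t)
  case (Var x)
  then show ?case using assignment_reps(2)[OF assms] by simp
next
  case (Op f ts)
  let ?s = "psubst \<Omega> (\<lambda>x. rep (\<alpha> x))"
  \<comment> \<open>\<open>Subst\<close> transports equalities only, so being ok is carried along by
    the reflexive equality and recovered by well-formedness.\<close>
  have "(\<Gamma>, Ok (?s (Op f ts))) \<in> T"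
    using assignment_reps(3)[OF assms refl[OF Op.prems]] by (rule QEq_imp_ok)
  note opn_cls[OF this[unfolded psubst.simps]]
  moreover have "restrict (\<lambda>i. interp \<Omega> term_model (ts i) \<alpha>) (arity \<Omega> f)
      = restrict (\<lambda>i. cls (restrict (\<lambda>i. ?s (ts i)) (arity \<Omega> f) i)) (arity \<Omega> f)"
    using Op.IH ok_OpD(1)[OF Op.prems] by (auto simp: restrict_def fun_eq_iff)
  ultimately show ?case by simp
qed

lemma sup_dist_interp_le:
  assumes \<Delta>: "\<Delta> \<in> contexts" and eq: "(\<Delta>, QEq s \<epsilon> t) \<in> T"
  shows "sup_dist (assignments term_model \<Delta>) dst (interp \<Omega> term_model s) (interp \<Omega> term_model t)
    \<le> ennreal \<epsilon>"
  unfolding sup_dist_def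
proof (rule SUP_least)
  fix \<alpha> assume \<alpha>: "\<alpha> \<in> assignments term_model \<Delta>"
  note eq' = assignment_reps(3)[OF \<alpha> \<Delta> eq]
  show "dst (interp \<Omega> term_model s \<alpha>) (interp \<Omega> term_model t \<alpha>) \<le> ennreal \<epsilon>"
    using dst_le_iff[OF QEq_imp_ok[OF eq'] QEq_nonneg[OF eq]] eq'
      interp_term_model[OF \<alpha> \<Delta>] QEq_imp_ok[OF eq] by simp
qed

lemma sat_ok_term_model:
  assumes "\<Delta> \<in> contexts"
  shows "(\<Delta>, Ok t) \<in> T \<Longrightarrow> sat_ok \<Omega> term_model \<Delta> t"
proof (induction t)
  case (Op f ts)
  have "sup_dist (assignments term_model \<Delta>) dst (interp \<Omega> term_model (ts i))
      (interp \<Omega> term_model (ts j)) \<le> adist \<Omega> f i j"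
    if ij: "i \<in> arity \<Omega> f" "j \<in> arity \<Omega> f" for i j
    using sup_dist_interp_le[OF assms ok_OpD(2)[OF Op.prems ij]]
    \<comment> \<open>At infinite arity distance \<open>App\<close> gives no equality, and the
      required bound is vacuous.\<close>
    by (cases "adist \<Omega> f i j < \<infinity>") (simp_all add: not_less top_unique)
  then show ?case
    using Op.IH ok_OpD(1)[OF Op.prems] by simp
qed simp

lemma theory_model_term_model: "theory_model \<Omega> T term_model"
  unfolding theory_model_def
proof (intro conjI ballI signature_model_term_model)
  fix J assume J: "J \<in> T"
  then have "fst J \<in> contexts"
    using metric_theory by (auto simp: metric_equational_theory_def judgements_def)
  with J show "satisfies \<Omega> term_model J"
  proof (cases "(\<Omega>, term_model, J)" rule: satisfies.cases)
    case 1
    then show ?thesis using J \<open>fst J \<in> contexts\<close> sat_ok_term_model by auto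
  next
    case 2
    then show ?thesis
      using J \<open>fst J \<in> contexts\<close> sat_ok_term_model sup_dist_interp_le QEq_imp_ok by auto
  qed
qed

section \<open>The canonical assignment and completeness\<close>

lemma canonical_assignment: "(\<lambda>x. cls (Var x)) \<in> assignments term_model \<Gamma>"
proof -
  have "dst (cls (Var x)) (cls (Var y)) \<le> ennreal \<delta>" if "(x, \<delta>, y) \<in> set \<Gamma>" for x \<delta> y
    using dst_le_iff[OF var[OF ctxt] var[OF ctxt]] assum[OF ctxt that]
      QEq_nonneg[OF assum[OF ctxt that]] by blast
  then show ?thesis
    using cls_in_carrier[OF var[OF ctxt]] by (auto simp: assignments_def)
qed

text \<open>Both conclusions are proved together: the values at the canonical assignment turn the
  semantic bounds on the arguments into the equalities that \<open>App\<close> needs, and the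
  resulting ok judgement allows \<open>opn_cls\<close> to evaluate the whole term.\<close>

lemma sat_ok_imp_ok:
  assumes "t \<in> preterms \<Omega>"
  shows "sat_ok \<Omega> term_model \<Gamma> t \<Longrightarrow>
    (\<Gamma>, Ok t) \<in> T \<and> interp \<Omega> term_model t (\<lambda>x. cls (Var x)) = cls t"
  using assms
proof induction
  case (Var x)
  then show ?case using var[OF ctxt] by simp
next
  case (Op f ts)
  have IH: "(\<Gamma>, Ok (ts i)) \<in> T" "interp \<Omega> term_model (ts i) (\<lambda>x. cls (Var x)) = cls (ts i)"
    if "i \<in> arity \<Omega> f" for i
    using Op.IH[OF that] Op.prems that by simp_all
  have ok: "(\<Gamma>, Ok (Op f ts)) \<in> T"
  proof (rule app[OF ctxt])
    show "Op f ts \<in> preterms \<Omega>"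
      using Op.hyps by (intro preterms.Op)
  next
    fix i j assume ij: "i \<in> arity \<Omega> f" "j \<in> arity \<Omega> f" "adist \<Omega> f i j < \<infinity>"
    have "sup_dist (assignments term_model \<Gamma>) dst (interp \<Omega> term_model (ts i))
        (interp \<Omega> term_model (ts j)) \<le> adist \<Omega> f i j"
      using Op.prems ij(1,2) by simp
    from sup_dist_leD[OF this canonical_assignment]
    have "dst (cls (ts i)) (cls (ts j)) \<le> adist \<Omega> f i j"
      using IH(2)[OF ij(1)] IH(2)[OF ij(2)] by simp
    then show "(\<Gamma>, QEq (ts i) (enn2real (adist \<Omega> f i j)) (ts j)) \<in> T"
      using dst_le_iff_finite[OF IH(1)[OF ij(1)] IH(1)[OF ij(2)]] ij(3) by blast
  qed (rule IH(1))
  moreover have "restrict (\<lambda>i. interp \<Omega> term_model (ts i) (\<lambda>x. cls (Var x))) (arity \<Omega> f)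
      = restrict (\<lambda>i. cls (ts i)) (arity \<Omega> f)"
    using IH(2) by (auto simp: restrict_def fun_eq_iff)
  ultimately show ?case
    using opn_cls[OF ok] by simp
qed

lemma satisfies_imp_in_theory:
  assumes "\<phi> \<in> formulas \<Omega>" and sat: "satisfies \<Omega> term_model (\<Gamma>, \<phi>)"
  shows "(\<Gamma>, \<phi>) \<in> T"
proof (cases \<phi>)
  case (Ok t)
  then show ?thesis using assms sat_ok_imp_ok by (auto simp: formulas_def)
next
  case (QEq s \<epsilon> t)
  have st: "s \<in> preterms \<Omega>" "t \<in> preterms \<Omega>" "0 \<le> \<epsilon>"
    using assms(1) QEq by (auto simp: formulas_def)
  have s: "(\<Gamma>, Ok s) \<in> T" "interp \<Omega> term_model s (\<lambda>x. cls (Var x)) = cls s"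
    and t: "(\<Gamma>, Ok t) \<in> T" "interp \<Omega> term_model t (\<lambda>x. cls (Var x)) = cls t"
    using sat_ok_imp_ok[OF st(1)] sat_ok_imp_ok[OF st(2)] sat QEq by auto
  have "sup_dist (assignments term_model \<Gamma>) dst (interp \<Omega> term_model s)
      (interp \<Omega> term_model t) \<le> ennreal \<epsilon>"
    using sat QEq by simp
  from sup_dist_leD[OF this canonical_assignment]
  have "dst (cls s) (cls t) \<le> ennreal \<epsilon>"
    using s(2) t(2) by simp
  then show ?thesis
    using dst_le_iff[OF s(1) t(1) st(3)] QEq by simp
qed

end

theorem theorem1:
  fixes \<Omega> :: "'f signature"
    and T :: "('f, 'x) judgement set"
    and \<Gamma> :: "'x ctxt"
    and \<phi> :: "('f, 'x) formula"
  assumes "countable (UNIV :: 'x set)" and "infinite (UNIV :: 'x set)"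
    and "metric_signature \<Omega>"
    and "metric_equational_theory \<Omega> T"
    and "\<Gamma> \<in> contexts" and "\<phi> \<in> formulas \<Omega>"
    and "\<And>M :: ('f, ('f, 'x) preterm set) model. theory_model \<Omega> T M \<Longrightarrow> satisfies \<Omega> M (\<Gamma>, \<phi>)"
  shows "(\<Gamma>, \<phi>) \<in> T"
proof -
  interpret theory_in_context \<Omega> T \<Gamma>
    using assms(4,5) by unfold_locales
  \<comment> \<open>Elements of the term model are sets of preterms, so it is among the models over
    which the hypothesis ranges.\<close>
  show ?thesis
    using satisfies_imp_in_theory[OF assms(6)] assms(7)[OF theory_model_term_model] .
qed

end
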